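(* Let $m,n\ge 1$ and let $\mathcal G=\{I,X,Y,Z\}$ be the Pauli group modulo global phase, identified with $\mathrm{GF}(2)^2$ via $I\leftrightarrow(0,0)$, $X\leftrightarrow(0,1)$, $Y\leftrightarrow(1,0)$, $Z\leftrightarrow(1,1)$. Let $M\in\mathcal G^{m\times n}$ be any target pattern and let $X_1,X_2\in \mathrm{GF}(2)^{m\times n}$ be the matrices such that, for all $i,j$, the entry $M_{ij}$ corresponds to $((X_2)_{ij},(X_1)_{ij})$. Equivalently, $M$ corresponds to the $m\times n\times 2$ tensor $$\mathcal T = X_1\otimes\begin{bmatrix}0\\1\end{bmatrix}+X_2\otimes\begin{bmatrix}1\\0\end{bmatrix}$$ over $\mathrm{GF}(2)$. Let $r$ be the minimum number of addressing layers realizing $M$ (equivalently, the tensor rank of $\mathcal T$ over $\mathrm{GF}(2)$), and let $$\Delta=\min\{\mathrm{rank}(X_1)+\mathrm{rank}(X_2),\ \mathrm{rank}(X_1)+\mathrm{rank}(X_1+X_2),\ \mathrm{rank}(X_2)+\mathrm{rank}(X_1+X_2)\},$$ where all ranks are over $\mathrm{GF}(2)$. Then the algorithm which, among the three identities $$\mathcal T = X_1 \otimes \begin{bmatrix}0\\1\end{bmatrix} + X_2 \otimes \begin{bmatrix}1\\0\end{bmatrix}= (X_1 + X_2)\otimes \begin{bmatrix}0\\1\end{bmatrix} + X_2 \otimes \begin{bmatrix}1\\1\end{bmatrix}= X_1 \otimes \begin{bmatrix}1\\1\end{bmatrix} + (X_1 + X_2) \otimes \begin{bmatrix}1\\0\end{bmatrix},$$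 selects the one whose two matrices have the smallest sum of ranks, and decomposes each of these two matrices into a minimum number of rank-one matrices over $\mathrm{GF}(2)$, yields a realization of $M$ with exactly $\Delta$ addressing layers, and $$\Delta\le \tfrac43\, r .$$
   Context: An addressing layer on an $m\times n$ array is specified by $u\in\{0,1\}^m$, $v\in\{0,1\}^n$ and $G\in\mathcal G$; it is the matrix $(uv^\top)\cdot G\in\mathcal G^{m\times n}$ whose $(i,j)$ entry is $G$ if $u_iv_j=1$ and the identity element if $u_iv_j=0$. A realization of $M$ with $k$ layers is an expression $M=\sum_{t=1}^k (u_tv_t^\top)\cdot G_t$, where the sum is entrywise in the group $\mathcal G$. Under the identification of $\mathcal G$ with $\mathrm{GF}(2)^2$, the group operation is componentwise addition modulo $2$. For a matrix $A\in\mathrm{GF}(2)^{m\times n}$ and $g\in\mathrm{GF}(2)^2$, $A\otimes g$ is the $m\times n\times 2$ tensor with entries $A_{ij}g_l$. The tensor rank is the minimum number of terms in an expression as a sum of tensors $u\otimes v\otimes g$ with $u\in \mathrm{GF}(2)^m$, $v\in\mathrm{GF}(2)^n$, $g\in\mathrm{GF}(2)^2$. *)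

theory Defs
  imports "HOL-Analysis.Analysis" "HOL-Library.Z2"
begin

text \<open>
  GF(2) is the field \<^typ>\<open>bit\<close>, and an \<open>m \<times> n\<close> matrix is an element of
  \<open>_ ^ 'n ^ 'm\<close>; index types are nonempty, so \<open>m, n \<ge> 1\<close> holds automatically.
\<close>

section \<open>The Pauli group modulo global phase\<close>

datatype pauli = PI | PX | PY | PZ

text \<open>
  The group is written additively, because realizations are entrywise sums; the neutral
  element is \<^term>\<open>PI\<close>. Lemma \<open>pauli_mat_mult_iff\<close> below relates the table to the
  product of Pauli matrices up to a phase.
\<close>

instantiation pauli :: ab_group_add
begin

fun plus_pauli :: "pauli \<Rightarrow> pauli \<Rightarrow> pauli" where
  "PI + p = p"
| "p + PI = p"
| "PX + PX = PI" | "PX + PY = PZ" | "PX + PZ = PY"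
| "PY + PX = PZ" | "PY + PY = PI" | "PY + PZ = PX"
| "PZ + PX = PY" | "PZ + PY = PX" | "PZ + PZ = PI"

definition zero_pauli :: pauli where "0 = PI"

definition uminus_pauli :: "pauli \<Rightarrow> pauli" where "- p = (p :: pauli)"

definition minus_pauli :: "pauli \<Rightarrow> pauli \<Rightarrow> pauli" where "p - q = p + (q :: pauli)"

instance
proof
  fix a b c :: pauli
  show "a + b + c = a + (b + c)" by (cases a; cases b; cases c) simp_all
  show "a + b = b + a" by (cases a; cases b) simp_all
  show "0 + a = a" by (simp add: zero_pauli_def)
  show "- a + a = 0" by (cases a) (simp_all add: zero_pauli_def uminus_pauli_def)
  show "a - b = a + - b" by (simp add: minus_pauli_def uminus_pauli_def)
qed

end

fun pauli_mat :: "pauli \<Rightarrow> complex^2^2" where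
  "pauli_mat PI = vector [vector [1, 0], vector [0, 1]]"
| "pauli_mat PX = vector [vector [0, 1], vector [1, 0]]"
| "pauli_mat PY = vector [vector [0, - \<i>], vector [\<i>, 0]]"
| "pauli_mat PZ = vector [vector [1, 0], vector [0, - 1]]"

lemma pauli_mat_mult:
  "\<exists>c. cmod c = 1 \<and> pauli_mat p ** pauli_mat q = (\<chi> i j. c * pauli_mat (p + q) $ i $ j)"
proof -
  have "\<exists>c\<in>{1, -1, \<i>, -\<i>}. pauli_mat p ** pauli_mat q = (\<chi> i j. c * pauli_mat (p + q) $ i $ j)"
    by (cases p; cases q)
       (simp_all add: vec_eq_iff matrix_matrix_mult_def forall_2 sum_2)
  then obtain c where "c \<in> {1, -1, \<i>, -\<i>}"
    and *: "pauli_mat p ** pauli_mat q = (\<chi> i j. c * pauli_mat (p + q) $ i $ j)" ..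
  then have "cmod c = 1" by auto
  with * show ?thesis by blast
qed

lemma pauli_mat_inj_phase:
  assumes "cmod c = 1" "cmod d = 1"
    and "(\<chi> i j. c * pauli_mat p $ i $ j) = (\<chi> i j. d * pauli_mat q $ i $ j)"
  shows "p = q"
proof -
  have "c \<noteq> 0" "d \<noteq> 0" using assms by auto
  with assms(3) show ?thesis
    by (cases p; cases q) (auto simp: vec_eq_iff forall_2)
qed

lemma pauli_mat_mult_iff:
  "(\<exists>c. cmod c = 1 \<and> pauli_mat p ** pauli_mat q = (\<chi> i j. c * pauli_mat r $ i $ j))
     \<longleftrightarrow> r = p + q"
  using pauli_mat_mult pauli_mat_inj_phase by metis

fun pauli_code :: "pauli \<Rightarrow> bit^2" where
  "pauli_code PI = vector [0, 0]"
| "pauli_code PX = vector [0, 1]"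
| "pauli_code PY = vector [1, 0]"
| "pauli_code PZ = vector [1, 1]"

lemma pauli_code_add: "pauli_code (p + q) = pauli_code p + pauli_code q"
  by (cases p; cases q) (simp_all add: vec_eq_iff forall_2)

lemma bij_pauli_code: "bij pauli_code"
proof (rule bijI)
  show "inj pauli_code"
  proof (rule injI)
    fix p q assume "pauli_code p = pauli_code q"
    then show "p = q"
      by (cases p; cases q) (auto simp: vec_eq_iff forall_2)
  qed
  show "surj pauli_code"
  proof (rule surjI)
    fix g :: "bit^2"
    show "pauli_code (if g $ 1 = 0 then (if g $ 2 = 0 then PI else PX)
                      else (if g $ 2 = 0 then PY else PZ)) = g"
      by (auto simp: vec_eq_iff forall_2)
  qed
qed

section \<open>Addressing layers\<close>

definition addressing_layer :: "bit^'m \<Rightarrow> bit^'n \<Rightarrow> pauli \<Rightarrow> pauli^'n^'m" where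
  "addressing_layer u v G = (\<chi> i j. if u $ i * v $ j = 1 then G else PI)"

definition realizes :: "((bit^'m) \<times> (bit^'n) \<times> pauli) list \<Rightarrow> pauli^'n^'m \<Rightarrow> bool" where
  "realizes ls M \<longleftrightarrow> M = (\<Sum>(u, v, G)\<leftarrow>ls. addressing_layer u v G)"

definition min_layers :: "pauli^'n^'m \<Rightarrow> nat" where
  "min_layers M = (LEAST k. \<exists>ls. length ls = k \<and> realizes ls M)"

section \<open>Tensors\<close>

definition tensor3 :: "'a::field^'m \<Rightarrow> 'a^'n \<Rightarrow> 'a^'p \<Rightarrow> 'a^'p^'n^'m" where
  "tensor3 u v g = (\<chi> i j l. u $ i * v $ j * g $ l)"

definition tensor_rank :: "'a::field^'p^'n^'m \<Rightarrow> nat" where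
  "tensor_rank T = (LEAST k. \<exists>ts. length ts = k \<and> T = (\<Sum>(u, v, g)\<leftarrow>ts. tensor3 u v g))"

definition mat_tensor :: "'a::field^'n^'m \<Rightarrow> 'a^'p \<Rightarrow> 'a^'p^'n^'m" (infixl "\<otimes>\<^sub>t" 70) where
  "A \<otimes>\<^sub>t g = (\<chi> i j l. A $ i $ j * g $ l)"

section \<open>The algorithm\<close>

definition outer :: "'a::field^'m \<Rightarrow> 'a^'n \<Rightarrow> 'a^'n^'m" where
  "outer u v = (\<chi> i j. u $ i * v $ j)"

definition rank_one_decomp :: "'a::field^'n^'m \<Rightarrow> (('a^'m) \<times> ('a^'n)) list \<Rightarrow> bool" where
  "rank_one_decomp A ps \<longleftrightarrow>
     (\<forall>(u, v)\<in>set ps. rank (outer u v) = 1) \<and> A = (\<Sum>(u, v)\<leftarrow>ps. outer u v)"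

definition min_rank_one_decomp :: "'a::field^'n^'m \<Rightarrow> (('a^'m) \<times> ('a^'n)) list \<Rightarrow> bool" where
  "min_rank_one_decomp A ps \<longleftrightarrow>
     rank_one_decomp A ps \<and> (\<forall>qs. rank_one_decomp A qs \<longrightarrow> length ps \<le> length qs)"

definition splittings ::
  "bit^'n^'m \<Rightarrow> bit^'n^'m \<Rightarrow> (((bit^'n^'m) \<times> (bit^2)) \<times> ((bit^'n^'m) \<times> (bit^2))) set" where
  "splittings X1 X2 =
     {((X1, vector [0, 1]), (X2, vector [1, 0])),
      ((X1 + X2, vector [0, 1]), (X2, vector [1, 1])),
      ((X1, vector [1, 1]), (X1 + X2, vector [1, 0]))}"

definition layers_of :: "((bit^'m) \<times> (bit^'n)) list \<Rightarrow> bit^2 \<Rightarrow> ((bit^'m) \<times> (bit^'n) \<times> pauli) list" where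
  "layers_of ps g = map (\<lambda>(u, v). (u, v, inv pauli_code g)) ps"

text \<open>
  The algorithm prescribes neither how ties between the three splittings are broken nor
  which minimum decompositions are chosen, so it is modelled by the set of all lists of
  layers that it may output.
\<close>

definition algorithm_outputs ::
  "bit^'n^'m \<Rightarrow> bit^'n^'m \<Rightarrow> ((bit^'m) \<times> (bit^'n) \<times> pauli) list set" where
  "algorithm_outputs X1 X2 =
     {layers_of ps g @ layers_of qs h | A g B h ps qs.
        ((A, g), (B, h)) \<in> splittings X1 X2 \<and>
        (\<forall>((A', g'), (B', h')) \<in> splittings X1 X2. rank A + rank B \<le> rank A' + rank B') \<and>
        min_rank_one_decomp A ps \<and> min_rank_one_decomp B qs}"

end

theory Submission
  imports Defs
begin

text \<open>
  Contracting the third mode of a tensor decomposition with a functional \<open>w\<close> gives a matrix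
  whose rank is at most the number of terms \<open>u \<otimes> v \<otimes> g\<close> with \<open>w \<bullet> g \<noteq> 0\<close>. Over GF(2) the
  three nonzero functionals on \<open>GF(2)\<^sup>2\<close> yield \<open>X\<^sub>1\<close>, \<open>X\<^sub>2\<close> and \<open>X\<^sub>1 + X\<^sub>2\<close>, and every nonzero
  \<open>g\<close> is annihilated by exactly one of them. So the three ranks add up to at most \<open>2r\<close>, and the
  sum of the two smallest is at most two thirds of that.
\<close>

section \<open>Rank-one decompositions of matrices\<close>

lemma sum_list_vec_nth: "(\<Sum>x\<leftarrow>xs. f x) $ i = (\<Sum>x\<leftarrow>xs. f x $ i)"
  by (induction xs) simp_all

text \<open>Each row of the sum is a combination of the right factors \<open>v\<close>, so the row
  space is spanned by at most \<open>length ps\<close> vectors.\<close>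

lemma rank_sum_outer_le:
  fixes ps :: "(('a::field^'m) \<times> ('a^'n)) list"
  shows "rank (\<Sum>(u, v)\<leftarrow>ps. outer u v) \<le> length ps"
proof -
  have "(\<Sum>(u, v)\<leftarrow>ps. outer u v) $ i \<in> vec.span (snd ` set ps)" for i
  proof -
    \<comment> \<open>The induction runs over a separate list \<open>qs\<close> so that the span
      stays that of the full list \<open>ps\<close>.\<close>
    have "(\<Sum>p\<leftarrow>qs. case p of (u, v) \<Rightarrow> outer u v) $ i \<in> vec.span (snd ` set ps)"
      if "set qs \<subseteq> set ps" for qs
      using that
    proof (induction qs)
      case Nil
      show ?case by (simp add: vec.span_zero)
    next
      case (Cons p qs)
      obtain u v where p: "p = (u, v)" by (cases p)
      with Cons.prems have "v \<in> snd ` set ps" by force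
      then have "u $ i *s v \<in> vec.span (snd ` set ps)"
        by (intro vec.span_scale vec.span_base)
      moreover have "outer u v $ i = u $ i *s v"
        by (simp add: outer_def vec_eq_iff)
      ultimately show ?case
        using Cons p by (simp add: vec.span_add)
    qed
    then show ?thesis by simp
  qed
  then have "rows (\<Sum>(u, v)\<leftarrow>ps. outer u v) \<subseteq> vec.span (snd ` set ps)"
    by (auto simp: rows_def row_def vec_nth_inverse)
  then have "rank (\<Sum>(u, v)\<leftarrow>ps. outer u v) \<le> card (snd ` set ps)"
    unfolding row_rank_def_gen by (intro vec.dim_le_card) simp_all
  also have "\<dots> \<le> length ps"
    by (metis card_length length_map list.set_map)
  finally show ?thesis .
qed

lemma rank_eq_0D:
  fixes A :: "'a::field^'n^'m"
  assumes "rank A = 0"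
  shows "A = 0"
proof -
  have "rows A \<subseteq> {0}"
    using assms unfolding row_rank_def_gen by (simp add: vec.dim_eq_0)
  then have "A $ i = 0" for i
    by (force simp: rows_def row_def vec_nth_inverse)
  then show ?thesis
    by (simp add: vec_eq_iff)
qed

text \<open>Rank factorization: the right factors form a basis of the row space chosen among the
  rows, and the left factors hold the coordinates of all rows in that basis.\<close>

lemma obtain_outer_decomp:
  fixes A :: "'a::field^'n^'m"
  obtains ps where "A = (\<Sum>(u, v)\<leftarrow>ps. outer u v)" "length ps = rank A"
proof -
  obtain B where B: "B \<subseteq> rows A" "rows A \<subseteq> vec.span B" "card B = vec.dim (rows A)"
    using vec.basis_exists by metis
  have "finite (rows A)"
    by (simp add: rows_def full_SetCompr_eq)
  with B(1) have "finite B" by (rule finite_subset)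
  then obtain bs where bs: "set bs = B" "distinct bs"
    using finite_distinct_list by blast
  have "\<exists>c. A $ i = (\<Sum>b\<in>B. c b *s b)" for i
  proof -
    have "A $ i \<in> vec.span B"
      using B(2) by (force simp: rows_def row_def vec_nth_inverse)
    then show ?thesis
      using vec.span_finite[OF \<open>finite B\<close>] by auto
  qed
  then obtain c where c: "A $ i = (\<Sum>b\<in>B. c i b *s b)" for i
    by metis
  \<comment> \<open>The left factor paired with \<open>b\<close> collects the coefficient of
    \<open>b\<close> in every row.\<close>
  define ps where "ps = map (\<lambda>b. ((\<chi> i. c i b), b)) bs"
  have "A $ i = (\<Sum>(u, v)\<leftarrow>ps. outer u v) $ i" for i
  proof -
    have "(\<Sum>(u, v)\<leftarrow>ps. outer u v) $ i = (\<Sum>b\<leftarrow>bs. c i b *s b)"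
      by (simp add: ps_def sum_list_vec_nth o_def outer_def vector_scalar_mult_def)
    also have "\<dots> = A $ i"
      using c bs by (simp add: sum_list_distinct_conv_sum_set)
    finally show ?thesis ..
  qed
  then have "A = (\<Sum>(u, v)\<leftarrow>ps. outer u v)"
    by (simp add: vec_eq_iff)
  moreover have "length ps = rank A"
    using B(3) bs distinct_card by (force simp: ps_def row_rank_def_gen)
  ultimately show thesis by (rule that)
qed

lemma rank_one_decomp_length_ge:
  assumes "rank_one_decomp A ps"
  shows "rank A \<le> length ps"
  using assms rank_sum_outer_le[of ps] by (simp add: rank_one_decomp_def)

text \<open>Dropping the zero terms of a rank factorization leaves the sum unchanged, and the lower
  bound on the length shows that nothing was actually dropped.\<close>

lemma obtain_rank_one_decomp:
  fixes A :: "'a::field^'n^'m"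
  obtains ps where "rank_one_decomp A ps" "length ps = rank A"
proof -
  obtain ps where ps: "A = (\<Sum>(u, v)\<leftarrow>ps. outer u v)" "length ps = rank A"
    by (rule obtain_outer_decomp)
  define qs where "qs = filter (\<lambda>(u, v). rank (outer u v) = 1) ps"
  \<comment> \<open>A single outer product has rank at most 1, so rank different from 1 means rank
    0.\<close>
  have "outer u v = 0" if "rank (outer u v) \<noteq> 1" for u :: "'a^'m" and v :: "'a^'n"
    using that rank_sum_outer_le[of "[(u, v)]"] by (intro rank_eq_0D) simp
  then have "(\<Sum>(u, v)\<leftarrow>qs. outer u v) = (\<Sum>(u, v)\<leftarrow>ps. outer u v)"
    unfolding qs_def by (intro sum_list_map_filter) auto
  with ps(1) have "rank_one_decomp A qs"
    by (auto simp: rank_one_decomp_def qs_def)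
  moreover have "length qs = rank A"
    using rank_one_decomp_length_ge[OF calculation] ps(2)
    by (metis length_filter_le le_antisym qs_def)
  ultimately show thesis by (rule that)
qed

text \<open>The lower bound \<open>rank A\<close> is attained, so minimality fixes the length; this
  is what makes the number of layers computable from ranks.\<close>

lemma min_rank_one_decomp_iff:
  "min_rank_one_decomp A ps \<longleftrightarrow> rank_one_decomp A ps \<and> length ps = rank A"
  unfolding min_rank_one_decomp_def
  using obtain_rank_one_decomp[of A] rank_one_decomp_length_ge[of A] by (metis le_antisym)

section \<open>Tensors and layers\<close>

lemma mat_tensor_sum_outer:
  "(\<Sum>(u, v)\<leftarrow>ps. outer u v) \<otimes>\<^sub>t g = (\<Sum>(u, v)\<leftarrow>ps. tensor3 u v g)"
proof (induction ps)
  case Nil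
  show ?case by (simp add: mat_tensor_def vec_eq_iff)
next
  case (Cons p ps)
  then show ?case
    by (cases p) (simp add: mat_tensor_def outer_def tensor3_def vec_eq_iff algebra_simps)
qed

lemma pauli_code_zero: "pauli_code 0 = 0"
  by (simp add: zero_pauli_def vec_eq_iff forall_2)

lemma pauli_code_addressing_layer:
  "pauli_code (addressing_layer u v G $ i $ j) = tensor3 u v (pauli_code G) $ i $ j"
  by (cases "u $ i"; cases "v $ j")
     (simp_all add: addressing_layer_def tensor3_def vec_eq_iff forall_2)

text \<open>Applied entrywise, \<open>pauli_code\<close> is an injective homomorphism that turns a
  layer into a rank-one tensor, so an equation between patterns is the same as one between their
  codes.\<close>

lemma realizes_iff_tensor:
  assumes "\<And>i j. pauli_code (M $ i $ j) = T $ i $ j"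
  shows "realizes ls M \<longleftrightarrow> T = (\<Sum>(u, v, G)\<leftarrow>ls. tensor3 u v (pauli_code G))"
proof -
  have *: "pauli_code ((\<Sum>(u, v, G)\<leftarrow>ls. addressing_layer u v G) $ i $ j)
      = (\<Sum>(u, v, G)\<leftarrow>ls. tensor3 u v (pauli_code G)) $ i $ j" for i j
    by (induction ls) (auto simp: pauli_code_zero pauli_code_add pauli_code_addressing_layer)
  have "realizes ls M \<longleftrightarrow> (\<forall>i j. pauli_code (M $ i $ j)
      = pauli_code ((\<Sum>(u, v, G)\<leftarrow>ls. addressing_layer u v G) $ i $ j))"
    \<comment> \<open>Extensionality is applied to the two matrix indices only, leaving equations
      between group elements to compare with those between codes.\<close>
    unfolding realizes_def vec_eq_iff[of M] vec_eq_iff[of "M $ _"]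
    using bij_pauli_code by (simp add: bij_def inj_eq)
  also have "\<dots> \<longleftrightarrow> T = (\<Sum>(u, v, G)\<leftarrow>ls. tensor3 u v (pauli_code G))"
    by (simp only: * assms) (simp add: vec_eq_iff)
  finally show ?thesis .
qed

text \<open>Translating the third factor by \<open>pauli_code\<close> or its inverse preserves
  length, so both minima are taken over the same set of numbers.\<close>

lemma min_layers_eq_tensor_rank:
  assumes "\<And>i j. pauli_code (M $ i $ j) = T $ i $ j"
  shows "min_layers M = tensor_rank T"
proof -
  have "(\<exists>ls. length ls = k \<and> realizes ls M) \<longleftrightarrow>
      (\<exists>ts. length ts = k \<and> T = (\<Sum>(u, v, g)\<leftarrow>ts. tensor3 u v g))" (is "?L \<longleftrightarrow> ?R") for k
  proof
    assume ?L
    then obtain ls where ls: "length ls = k" "realizes ls M" by blast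
    have "T = (\<Sum>(u, v, g)\<leftarrow>map (\<lambda>(u, v, G). (u, v, pauli_code G)) ls. tensor3 u v g)"
      using ls(2) by (simp add: realizes_iff_tensor[OF assms] o_def case_prod_unfold)
    with ls(1) show ?R by (metis length_map)
  next
    assume ?R
    then obtain ts where ts: "length ts = k" "T = (\<Sum>(u, v, g)\<leftarrow>ts. tensor3 u v g)" by blast
    have "realizes (map (\<lambda>(u, v, g). (u, v, inv pauli_code g)) ts) M"
      using ts(2) bij_pauli_code
      by (simp add: realizes_iff_tensor[OF assms] o_def case_prod_unfold bij_def surj_f_inv_f)
    with ts(1) show ?L by (metis length_map)
  qed
  then show ?thesis
    by (simp add: min_layers_def tensor_rank_def)
qed

lemma realizes_layers_of:
  fixes A B :: "bit^'n^'m"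
  assumes "\<And>i j. pauli_code (M $ i $ j) = (A \<otimes>\<^sub>t g + B \<otimes>\<^sub>t h) $ i $ j"
    and "rank_one_decomp A ps" "rank_one_decomp B qs"
  shows "realizes (layers_of ps g @ layers_of qs h) M"
proof -
  have "(\<Sum>(u, v, G)\<leftarrow>layers_of rs f. tensor3 u v (pauli_code G)) = C \<otimes>\<^sub>t f"
    if "rank_one_decomp C rs" for C :: "bit^'n^'m" and rs f
    using that bij_pauli_code mat_tensor_sum_outer[of rs f]
    by (simp add: rank_one_decomp_def layers_of_def o_def case_prod_unfold bij_def surj_f_inv_f)
  with assms(2,3) show ?thesis
    by (simp add: realizes_iff_tensor[OF assms(1)])
qed

text \<open>\<open>tensor_rank\<close> is a \<open>LEAST\<close>, so attaining it requires some
  decomposition to exist; decomposing the two slices provides one.\<close>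

lemma tensor_decomp_exists:
  fixes T :: "bit^2^'n^'m"
  obtains ts where "length ts = tensor_rank T" "T = (\<Sum>(u, v, g)\<leftarrow>ts. tensor3 u v g)"
proof -
  define slice where "slice l = (\<chi> i j. T $ i $ j $ l)" for l
  obtain ps where ps: "slice 1 = (\<Sum>(u, v)\<leftarrow>ps. outer u v)" by (rule obtain_outer_decomp)
  obtain qs where qs: "slice 2 = (\<Sum>(u, v)\<leftarrow>qs. outer u v)" by (rule obtain_outer_decomp)
  have "T = slice 1 \<otimes>\<^sub>t vector [1, 0] + slice 2 \<otimes>\<^sub>t vector [0, 1]"
    by (simp add: slice_def mat_tensor_def vec_eq_iff forall_2)
  also have "\<dots> = (\<Sum>(u, v, g)\<leftarrow>map (\<lambda>(u, v). (u, v, vector [1, 0])) ps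
      @ map (\<lambda>(u, v). (u, v, vector [0, 1])) qs. tensor3 u v g)"
    unfolding ps qs mat_tensor_sum_outer by (simp add: o_def case_prod_unfold)
  finally have "\<exists>k ts. length ts = k \<and> T = (\<Sum>(u, v, g)\<leftarrow>ts. tensor3 u v g)"
    by blast
  from LeastI_ex[OF this] show thesis
    using that unfolding tensor_rank_def by blast
qed

section \<open>Contraction of the third mode\<close>

definition contract :: "'a::field^'p \<Rightarrow> 'a^'p^'n^'m \<Rightarrow> 'a^'n^'m" where
  "contract w T = (\<chi> i j. \<Sum>l\<in>UNIV. w $ l * T $ i $ j $ l)"

text \<open>Contraction is linear and sends \<open>tensor3 u v g\<close> to an outer product scaled
  by the pairing of \<open>w\<close> with \<open>g\<close>, so only the terms with nonzero pairing
  survive.\<close>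

lemma rank_contract_le:
  fixes ts :: "(('a::field^'m) \<times> ('a^'n) \<times> ('a^'p)) list"
  shows "rank (contract w (\<Sum>(u, v, g)\<leftarrow>ts. tensor3 u v g))
    \<le> length (filter (\<lambda>(u, v, g). (\<Sum>l\<in>UNIV. w $ l * g $ l) \<noteq> 0) ts)"
proof -
  define d where "d g = (\<Sum>l\<in>UNIV. w $ l * g $ l)" for g
  define ps where "ps = map (\<lambda>(u, v, g). (d g *s u, v)) (filter (\<lambda>(u, v, g). d g \<noteq> 0) ts)"
  have add: "contract w (S + T) = contract w S + contract w T" for S T :: "'a^'p^'n^'m"
    by (simp add: contract_def vec_eq_iff distrib_left sum.distrib)
  have contract_tensor3: "contract w (tensor3 u v g) = outer (d g *s u) v" for u :: "'a^'m" and v :: "'a^'n" and g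
    by (simp add: contract_def tensor3_def outer_def d_def vec_eq_iff sum_distrib_left
        mult_ac)
  have "contract w (\<Sum>(u, v, g)\<leftarrow>ts. tensor3 u v g) = (\<Sum>(u, v)\<leftarrow>ps. outer u v)"
    unfolding ps_def
  proof (induction ts)
    case Nil
    show ?case by (simp add: contract_def vec_eq_iff)
  next
    case (Cons t ts)
    obtain u v g where "t = (u, v, g)" by (cases t)
    moreover have "outer (0 *s u) v = 0" by (simp add: outer_def vec_eq_iff)
    ultimately show ?case
      using Cons by (simp add: add contract_tensor3)
  qed
  then show ?thesis
    using rank_sum_outer_le[of ps] by (simp add: ps_def d_def)
qed

section \<open>Correctness and approximation ratio of the algorithm\<close>

theorem mainTheorem1:
  fixes M :: "pauli^'n^'m" and X1 X2 :: "bit^'n^'m" and T :: "bit^2^'n^'m"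
    and r \<Delta> :: nat
  assumes M: "\<forall>i j. pauli_code (M $ i $ j) = vector [X2 $ i $ j, X1 $ i $ j]"
    and T: "T = X1 \<otimes>\<^sub>t vector [0, 1] + X2 \<otimes>\<^sub>t vector [1, 0]"
    and r: "r = min_layers M"
    and \<Delta>: "\<Delta> = Min {rank X1 + rank X2, rank X1 + rank (X1 + X2), rank X2 + rank (X1 + X2)}"
  shows "(\<forall>i j. pauli_code (M $ i $ j) = T $ i $ j)
    \<and> r = tensor_rank T
    \<and> T = (X1 + X2) \<otimes>\<^sub>t vector [0, 1] + X2 \<otimes>\<^sub>t vector [1, 1]
    \<and> T = X1 \<otimes>\<^sub>t vector [1, 1] + (X1 + X2) \<otimes>\<^sub>t vector [1, 0]
    \<and> algorithm_outputs X1 X2 \<noteq> {}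
    \<and> (\<forall>ls \<in> algorithm_outputs X1 X2. realizes ls M \<and> length ls = \<Delta>)
    \<and> real \<Delta> \<le> 4 / 3 * real r"
proof (intro conjI)
  show code: "\<forall>i j. pauli_code (M $ i $ j) = T $ i $ j"
    by (simp add: M T mat_tensor_def vec_eq_iff forall_2)
  then show rank: "r = tensor_rank T"
    by (simp add: r min_layers_eq_tensor_rank)
  \<comment> \<open>Checking all bit values works because \<open>1 + 1 = 0\<close>: the two copies
    of \<open>X2\<close> in the second coordinate of the code cancel.\<close>
  have "T $ i $ j = ((X1 + X2) \<otimes>\<^sub>t vector [0, 1] + X2 \<otimes>\<^sub>t vector [1, 1]) $ i $ j" for i j
    by (cases "X1 $ i $ j"; cases "X2 $ i $ j")
       (simp_all add: T mat_tensor_def vec_eq_iff forall_2)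
  then show T2: "T = (X1 + X2) \<otimes>\<^sub>t vector [0, 1] + X2 \<otimes>\<^sub>t vector [1, 1]"
    by (simp add: vec_eq_iff[of T] vec_eq_iff[of "T $ _"])
  have "T $ i $ j = (X1 \<otimes>\<^sub>t vector [1, 1] + (X1 + X2) \<otimes>\<^sub>t vector [1, 0]) $ i $ j" for i j
    by (cases "X1 $ i $ j"; cases "X2 $ i $ j")
       (simp_all add: T mat_tensor_def vec_eq_iff forall_2)
  then show T3: "T = X1 \<otimes>\<^sub>t vector [1, 1] + (X1 + X2) \<otimes>\<^sub>t vector [1, 0]"
    by (simp add: vec_eq_iff[of T] vec_eq_iff[of "T $ _"])
  have split: "T = A \<otimes>\<^sub>t g + B \<otimes>\<^sub>t h" if "((A, g), (B, h)) \<in> splittings X1 X2" for A g B h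
    using that T T2 T3 by (auto simp: splittings_def)
  \<comment> \<open>The rank sums of the three splittings are exactly the members of the set
    defining \<Delta>, so being an optimal choice means having rank sum \<Delta>.\<close>
  have \<Delta>_eq: "rank A + rank B = \<Delta> \<longleftrightarrow>
      (\<forall>((A', g'), (B', h')) \<in> splittings X1 X2. rank A + rank B \<le> rank A' + rank B')"
    if "((A, g), (B, h)) \<in> splittings X1 X2" for A g B h
    using that unfolding splittings_def \<Delta> by (auto simp: min_def)
  have outputs: "algorithm_outputs X1 X2 = {layers_of ps g @ layers_of qs h | A g B h ps qs.
      ((A, g), (B, h)) \<in> splittings X1 X2 \<and> rank A + rank B = \<Delta> \<and>
      min_rank_one_decomp A ps \<and> min_rank_one_decomp B qs}"
    unfolding algorithm_outputs_def
    by (intro Collect_cong ex_cong1 conj_cong refl \<Delta>_eq[symmetric])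
  show "algorithm_outputs X1 X2 \<noteq> {}"
  proof -
    have nonempty: "algorithm_outputs X1 X2 \<noteq> {}"
      if AB: "((A, g), (B, h)) \<in> splittings X1 X2" "\<Delta> = rank A + rank B" for A g B h
    proof -
      obtain ps qs where "rank_one_decomp A ps" "length ps = rank A"
        "rank_one_decomp B qs" "length qs = rank B"
        by (metis obtain_rank_one_decomp)
      then have "min_rank_one_decomp A ps" "min_rank_one_decomp B qs"
        by (simp_all add: min_rank_one_decomp_iff)
      with AB have "layers_of ps g @ layers_of qs h \<in> algorithm_outputs X1 X2"
        unfolding outputs by blast
      then show ?thesis by blast
    qed
    \<comment> \<open>The minimum is attained, so some splitting is selectable and the algorithm has
      an output.\<close>
    have "\<Delta> \<in> {rank X1 + rank X2, rank X1 + rank (X1 + X2), rank X2 + rank (X1 + X2)}"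
      unfolding \<Delta> by (intro Min_in) simp_all
    then consider "\<Delta> = rank X1 + rank X2" | "\<Delta> = rank (X1 + X2) + rank X2"
      | "\<Delta> = rank X1 + rank (X1 + X2)"
      by auto
    then show ?thesis
    proof cases
      case 1
      show ?thesis by (rule nonempty[OF _ 1], unfold splittings_def, blast)
    next
      case 2
      show ?thesis by (rule nonempty[OF _ 2], unfold splittings_def, blast)
    next
      case 3
      show ?thesis by (rule nonempty[OF _ 3], unfold splittings_def, blast)
    qed
  qed
  show "\<forall>ls \<in> algorithm_outputs X1 X2. realizes ls M \<and> length ls = \<Delta>"
  proof
    fix ls assume "ls \<in> algorithm_outputs X1 X2"
    then obtain A g B h ps qs where ls: "ls = layers_of ps g @ layers_of qs h"
      and AB: "((A, g), (B, h)) \<in> splittings X1 X2" "rank A + rank B = \<Delta>"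
      and "min_rank_one_decomp A ps" "min_rank_one_decomp B qs"
      unfolding outputs by blast
    then have "rank_one_decomp A ps" "rank_one_decomp B qs" "length ls = \<Delta>"
      by (auto simp: min_rank_one_decomp_iff layers_of_def)
    then show "realizes ls M \<and> length ls = \<Delta>"
      using code split[OF AB(1)] by (auto simp: ls intro: realizes_layers_of)
  qed
  show "real \<Delta> \<le> 4 / 3 * real r"
  proof -
    obtain ts where ts: "length ts = r" "T = (\<Sum>(u, v, g)\<leftarrow>ts. tensor3 u v g)"
      using rank tensor_decomp_exists by metis
    define n where "n w = length (filter (\<lambda>(u, v, g). (\<Sum>l\<in>UNIV. w $ l * g $ l) \<noteq> 0) ts)"
      for w :: "bit^2"
    have le: "rank (contract w T) \<le> n w" for w
      unfolding n_def ts(2) by (rule rank_contract_le)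
    \<comment> \<open>The code lists \<open>X2\<close> first, so the second coordinate functional
      recovers \<open>X1\<close> and the first recovers \<open>X2\<close>.\<close>
    have "contract (vector [0, 1]) T = X1" "contract (vector [1, 0]) T = X2"
      "contract (vector [1, 1]) T = X2 + X1"
      by (simp_all add: contract_def T mat_tensor_def vec_eq_iff sum_2)
    then have "rank X1 + rank X2 + rank (X1 + X2)
        \<le> n (vector [0, 1]) + n (vector [1, 0]) + n (vector [1, 1])"
      using le by (metis add_mono add.commute[of X1 X2])
    \<comment> \<open>A term with \<open>g = 0\<close> is counted by none of the three functionals,
      any other term by exactly two.\<close>
    also have "\<dots> \<le> 2 * length ts"
      unfolding n_def by (induction ts) (auto simp: sum_2)
    \<comment> \<open>Each of the three pairwise rank sums is at least \<Delta>, and together they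
      count every rank twice: \<open>3 * \<Delta> \<le> 2 * (2 * r)\<close>.\<close>
    finally have "3 * \<Delta> \<le> 4 * r"
      unfolding \<Delta> ts(1) by (simp add: min_def)
    then show ?thesis by simp
  qed
qed

end
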